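(* For any $n\geq 1$, $$S_{n+1}(x)=(1+x)\sum_{r=1}^n\binom{n}{r-1}(-1)^{n-r}(1-x^2)^{\lfloor (n-r)/2\rfloor}S_r(x),$$ $$R_{n+1}(x)=(-1)^{n-1}(x-1)(1-x^2)^{\lfloor (n-1)/2\rfloor}+(1+x)\sum_{r=2}^{n+1}\binom{n}{r-2}(-1)^{n-r+1}(1-x^2)^{\lfloor (n-r+1)/2\rfloor}R_{r-1}(x).$$ Consequently, $S_n(x)$ is divisible by $(1+x)^{\lfloor n/2\rfloor}$ for $n\geq 1$, and $R_n(x)$ is divisible by $(1+x)^{\lfloor n/2\rfloor-1}$ for $n\geq 2$.
   Context: For $\pi=\pi(1)\cdots\pi(n)$ in the symmetric group $\mathfrak{S}_n$, an alternating run is a maximal segment of consecutive entries (of length at least two) that is increasing or decreasing; $\mathrm{run}(\pi)$ is the number of alternating runs (so $\mathrm{run}=0$ when $n=1$). The type $A$ alternating run polynomials are $R_n(x)=\sum_{\pi\in\mathfrak{S}_n}x^{\mathrm{run}(\pi)}$ for $n\ge 1$ (so $R_1(x)=1$, $R_2(x)=2x$, $R_3(x)=2x+4x^2$). The up-down run polynomials are $S_n(x)=\sum_{\pi\in\mathfrak{S}_n}x^{\mathrm{as}(\pi)}$, where $\mathrm{as}(\pi)$ is the number of alternating runs of the word $0\,\pi(1)\cdots\pi(n)$ (equivalently, the maximal length $k$ of a subsequence with $\pi(i_1)>\pi(i_2)<\pi(i_3)>\cdots\pi(i_k)$, $i_1<\cdots<i_k$); $S_0(x)=1$, $S_1(x)=x$,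 $S_2(x)=x+x^2$. *)

theory Defs
  imports Complex_Main "HOL-Combinatorics.Permutations" "HOL-Computational_Algebra.Polynomial"
begin

text \<open>The segment of \<open>w\<close> occupying the positions \<open>i, \<dots>, j\<close> (both included, counted from 0).\<close>

definition segment :: "'a list \<Rightarrow> nat \<Rightarrow> nat \<Rightarrow> 'a list" where
  "segment w i j = map (nth w) [i..<Suc j]"

definition monotone_segment :: "'a::linorder list \<Rightarrow> nat \<Rightarrow> nat \<Rightarrow> bool" where
  "monotone_segment w i j \<longleftrightarrow>
     i < j \<and> j < length w \<and>
     (sorted_wrt (<) (segment w i j) \<or> sorted_wrt (>) (segment w i j))"

text \<open>A run is represented by its first and last position.\<close>

definition alternating_runs :: "'a::linorder list \<Rightarrow> (nat \<times> nat) set" where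
  "alternating_runs w =
     {(i, j). monotone_segment w i j \<and>
        (\<forall>i' j'. i' \<le> i \<and> j \<le> j' \<and> monotone_segment w i' j' \<longrightarrow> i' = i \<and> j' = j)}"

definition perm_word :: "nat \<Rightarrow> (nat \<Rightarrow> nat) \<Rightarrow> nat list" where
  "perm_word n \<pi> = map \<pi> [1..<Suc n]"

definition run :: "nat \<Rightarrow> (nat \<Rightarrow> nat) \<Rightarrow> nat" where
  "run n \<pi> = card (alternating_runs (perm_word n \<pi>))"

definition up_down_run :: "nat \<Rightarrow> (nat \<Rightarrow> nat) \<Rightarrow> nat" where
  "up_down_run n \<pi> = card (alternating_runs (0 # perm_word n \<pi>))"

definition run_poly :: "nat \<Rightarrow> int poly" where
  "run_poly n = (\<Sum>\<pi> | \<pi> permutes {1..n}. monom 1 (run n \<pi>))"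

definition up_down_run_poly :: "nat \<Rightarrow> int poly" where
  "up_down_run_poly n = (\<Sum>\<pi> | \<pi> permutes {1..n}. monom 1 (up_down_run n \<pi>))"

end

theory Submission
  imports Defs "HOL-Combinatorics.Multiset_Permutations"
begin

text \<open>
  Runs are counted by their starting positions, that is, by the places where a word changes
  direction. Inserting the new maximum \<open>n + 1\<close> into a permutation word of length \<open>n\<close> in all
  possible ways and recording how the number of changes grows gives the differential recurrence
  \<open>S\<^bsub>n+1\<^esub> = (n x\<^sup>2 + x) S\<^bsub>n\<^esub> + x (1 - x\<^sup>2) S\<^bsub>n\<^esub>'\<close>
  (\<open>sum_turns_insert_max\<close>, \<open>up_down_run_poly_Suc\<close>).

  The first identity says that the exponential generating function of \<open>S\<^bsub>n+1\<^esub>\<close> is \<open>x / H\<close>, where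
  \<open>H = \<Sum>\<^sub>k h\<^sub>k z^k / k!\<close> with \<open>h\<^sub>0 = 1\<close> and
  \<open>h\<^bsub>k+1\<^esub> = - (1 + x) (-1)^k (1 - x\<^sup>2)^\<lfloor>k/2\<rfloor>\<close>. The \<open>h\<^sub>k\<close> satisfy a recurrence of
  the same shape (\<open>denom_coeff_Suc\<close>). Since the shift \<open>n \<mapsto> n + 1\<close>, multiplication by \<open>n\<close> and
  \<open>d/dx\<close> are all derivations of the binomial convolution, the two recurrences add up to one for
  the convolution itself. It starts with \<open>x\<close>, and the recurrence then makes every later
  term vanish (\<open>binconv_denom_coeff\<close>).

  Complementing the letters of a permutation exchanges initial ascents and initial descents, and
  the letter \<open>0\<close> in front creates an additional run exactly for the latter. Hence
  \<open>(1 + x) R\<^sub>n = 2 S\<^sub>n\<close> for \<open>n \<ge> 2\<close> (\<open>run_poly_mult\<close>), and the statements about \<open>R\<^sub>n\<close> follow from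
  those about \<open>S\<^sub>n\<close> by cancelling \<open>1 + x\<close>; the exceptional value \<open>(1 + x) R\<^sub>1 = 2 S\<^sub>1 - (x - 1)\<close>
  produces the inhomogeneous term.
\<close>

section \<open>Alternating runs as changes of direction\<close>

text \<open>The flag is the direction in which the first letter is entered, so that the number of turns
  of a word can be computed letter by letter.\<close>

fun turns :: "bool \<Rightarrow> 'a::linorder list \<Rightarrow> nat" where
  "turns up (a # b # w) = (if up = (a < b) then 0 else 1) + turns (a < b) (b # w)"
| "turns up w = 0"

lemma turns_eq_card:
  "turns up w = card {i. Suc i < length w \<and>
     (case i of 0 \<Rightarrow> up | Suc k \<Rightarrow> w ! k < w ! i) \<noteq> (w ! i < w ! Suc i)}"
    (is "_ = card (?T up w)")
proof (induction up w rule: turns.induct)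
  case (1 up a b w)
  have "?T up (a # b # w)
      = (if up = (a < b) then {} else {0}) \<union> Suc ` ?T (a < b) (b # w)"
  proof (rule set_eqI)
    fix i
    show "i \<in> ?T up (a # b # w) \<longleftrightarrow>
        i \<in> (if up = (a < b) then {} else {0}) \<union> Suc ` ?T (a < b) (b # w)"
      by (cases i) (auto simp: image_iff split: nat.splits)
  qed
  moreover have "finite (?T (a < b) (b # w))"
    by (rule finite_subset[of _ "{..<length (b # w)}"]) auto
  ultimately show ?case
    using 1 by (auto simp: card_insert_if card_image)
qed auto

lemma monotone_segment_iff:
  "monotone_segment w i j \<longleftrightarrow> i < j \<and> j < length w \<and>
     ((\<forall>k. i \<le> k \<and> k < j \<longrightarrow> w ! k < w ! Suc k) \<or> (\<forall>k. i \<le> k \<and> k < j \<longrightarrow> w ! k > w ! Suc k))"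
proof -
  have len: "length (segment w i j) = Suc j - i"
    by (simp add: segment_def del: upt_Suc)
  have nth: "segment w i j ! k = w ! (i + k)" if "k < Suc j - i" for k
    using that by (simp add: segment_def del: upt_Suc)
  have shift: "(\<forall>k. Suc k < length (segment w i j) \<longrightarrow>
      P (segment w i j ! k) (segment w i j ! Suc k))
      \<longleftrightarrow> (\<forall>k. i \<le> k \<and> k < j \<longrightarrow> P (w ! k) (w ! Suc k))" if "i < j" for P
  proof safe
    fix k
    assume *: "\<forall>k. Suc k < length (segment w i j) \<longrightarrow>
      P (segment w i j ! k) (segment w i j ! Suc k)" and "i \<le> k" "k < j"
    then show "P (w ! k) (w ! Suc k)"
      using *[rule_format, of "k - i"] by (simp add: len nth Suc_diff_le diff_less_mono)
  next
    fix k
    assume *: "\<forall>k. i \<le> k \<and> k < j \<longrightarrow> P (w ! k) (w ! Suc k)" and "Suc k < length (segment w i j)"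
    then show "P (segment w i j ! k) (segment w i j ! Suc k)"
      using *[rule_format, of "i + k"] that by (auto simp: len nth)
  qed
  have "transp ((<) :: 'a \<Rightarrow> _)" "transp ((>) :: 'a \<Rightarrow> _)"
    by (auto intro: transpI)
  then show ?thesis
    unfolding monotone_segment_def
    by (cases "i < j")
       (simp_all add: sorted_wrt_iff_nth_Suc_transp shift[of "(<)"] shift[of "\<lambda>a b. b < a"])
qed

text \<open>A run is determined by its first position, since of two runs with the same start one
  contains the other. A position other than the last starts a run iff the word turns there or it is
  position 0; the latter is made a turn by pretending that the word is entered against its first step.\<close>

lemma card_alternating_runs:
  assumes "distinct w"
  shows "card (alternating_runs w) = turns (\<not> w ! 0 < w ! 1) w"
proof -
  let ?start = "{i. Suc i < length w \<and>
     (case i of 0 \<Rightarrow> \<not> w ! 0 < w ! 1 | Suc k \<Rightarrow> w ! k < w ! i) \<noteq> (w ! i < w ! Suc i)}"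
  have inj: "inj_on fst (alternating_runs w)"
  proof (rule inj_onI, clarsimp)
    fix i j j'
    assume r: "(i, j) \<in> alternating_runs w" "(i, j') \<in> alternating_runs w"
    show "j = j'"
    proof (cases "j \<le> j'")
      case True
      then show ?thesis using r unfolding alternating_runs_def by blast
    next
      case False
      then have "j' \<le> j" by simp
      then show ?thesis using r unfolding alternating_runs_def by blast
    qed
  qed
  have neq: "w ! k < w ! Suc k \<or> w ! k > w ! Suc k" if "Suc k < length w" for k
    using assms that by (metis Suc_lessD n_not_Suc_n neqE nth_eq_iff_index_eq)
  have "fst ` alternating_runs w = ?start"
  proof (intro equalityI subsetI)
    fix i assume "i \<in> fst ` alternating_runs w"
    then obtain j where ij: "monotone_segment w i j"
      and max: "\<And>i' j'. i' \<le> i \<Longrightarrow> j \<le> j' \<Longrightarrow> monotone_segment w i' j' \<Longrightarrow> i' = i \<and> j' = j"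
      by (auto simp: alternating_runs_def)
    show "i \<in> ?start"
    proof (cases i)
      case 0
      then show ?thesis using ij by (auto simp: monotone_segment_iff)
    next
      case (Suc k)
      have "(w ! k < w ! i) \<noteq> (w ! i < w ! Suc i)"
      proof
        assume eq: "(w ! k < w ! i) = (w ! i < w ! Suc i)"
        have "monotone_segment w k j"
        proof (cases "w ! i < w ! Suc i")
          case True
          with ij have "\<forall>l. i \<le> l \<and> l < j \<longrightarrow> w ! l < w ! Suc l"
            unfolding monotone_segment_iff by (meson order.asym order_refl)
          then have "\<forall>l. k \<le> l \<and> l < j \<longrightarrow> w ! l < w ! Suc l"
            using eq True Suc by (metis le_antisym not_less_eq_eq)
          then show ?thesis using ij Suc by (auto simp: monotone_segment_iff)
        next
          case False
          with ij have "\<forall>l. i \<le> l \<and> l < j \<longrightarrow> w ! l > w ! Suc l"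
            unfolding monotone_segment_iff by (meson order.asym order_refl)
          moreover have "w ! k > w ! i"
            using neq[of k] eq False ij Suc by (auto simp: monotone_segment_iff)
          ultimately have "\<forall>l. k \<le> l \<and> l < j \<longrightarrow> w ! l > w ! Suc l"
            using Suc by (metis le_antisym not_less_eq_eq)
          then show ?thesis using ij Suc by (auto simp: monotone_segment_iff)
        qed
        then show False using max[of k j] Suc by auto
      qed
      then show ?thesis using ij Suc by (auto simp: monotone_segment_iff)
    qed
  next
    fix i assume i: "i \<in> ?start"
    let ?J = "{j. monotone_segment w i j}"
    have "?J \<subseteq> {..<length w}" by (auto simp: monotone_segment_iff)
    then have fin: "finite ?J" by (rule finite_subset) simp
    have "Suc i \<in> ?J"
      using i neq[of i] by (auto simp: monotone_segment_iff less_Suc_eq)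
    then have "Max ?J \<in> ?J" using fin Max_in by blast
    then have ij: "monotone_segment w i (Max ?J)" by simp
    moreover have "i' = i \<and> j' = Max ?J"
      if le: "i' \<le> i" "Max ?J \<le> j'" and m: "monotone_segment w i' j'" for i' j'
    proof -
      have lt: "i < j'" using ij le by (auto simp: monotone_segment_iff)
      have "i' = i"
      proof (rule ccontr)
        assume "i' \<noteq> i"
        then obtain k where k: "i = Suc k" "i' \<le> k" using le by (cases i) auto
        from m have "(w ! k < w ! i) = (w ! i < w ! Suc i)"
          unfolding monotone_segment_iff using lt k
          by (metis Suc_lessD le_Suc_eq order.asym)
        with i k show False by auto
      qed
      moreover from this have "j' \<le> Max ?J" using fin m by (intro Max_ge) auto
      ultimately show ?thesis using le by auto
    qed
    ultimately have "(i, Max ?J) \<in> alternating_runs w" by (auto simp: alternating_runs_def)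
    then show "i \<in> fst ` alternating_runs w" by force
  qed
  then show ?thesis using card_image[OF inj] unfolding turns_eq_card by metis
qed

section \<open>Inserting a new maximum\<close>

text \<open>
  The maximum \<open>N\<close> goes into a gap after a letter of \<open>a # v\<close>. In the two gaps next to an interior
  peak it just takes over the role of that peak. At the end of the word, if the last step ascends,
  the last gap prolongs the ascent and the gap before it adds one turn; if it descends, the last
  gap adds one turn. Every other gap gains a peak and a valley. For a word
  that is entered downwards and has \<open>k\<close> turns this amounts to \<open>k\<close> gaps that preserve the number
  of turns, one that adds a turn, and all others adding two.

  The induction needs a companion for words that are entered upwards. Its formula does not depend
  on how \<open>v\<close> begins once the gap in front of \<open>a\<close> is counted too, which is the extra
  summand on the left: there the word climbs to \<open>N\<close>, turns, and enters \<open>a # v\<close> downwards. In the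
  induction step from \<open>b # u\<close> to \<open>a # b # u\<close> with \<open>a < b\<close>, the gap between \<open>a\<close> and \<open>b\<close>
  contributes just the extra summand of the companion for \<open>b # u\<close>.
\<close>

lemma sum_turns_insert_max:
  fixes x :: "'r::comm_ring_1" and N :: "'a::linorder"
  assumes "\<forall>b \<in> set (a # v). b < N"
  defines "G \<equiv> \<lambda>up a v. \<Sum>i\<le>length v. x ^ turns up (a # take i v @ N # drop i v)"
    and "F \<equiv> \<lambda>c k m. of_nat c * x ^ k + x ^ Suc k + (of_nat m - of_nat k) * x ^ (k + 2)"
  shows "G False a v = F (turns False (a # v)) (turns False (a # v)) (length v) \<and>
    x ^ Suc (turns False (a # v)) + G True a v
      = F (Suc (turns True (a # v))) (turns True (a # v)) (length v)"
  using assms(1)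
proof (induction v arbitrary: a)
  case Nil
  then show ?case by (simp add: G_def F_def)
next
  case (Cons b u)
  from Cons.prems have lt: "a < N" "b < N" "\<not> N < b" by auto
  have IH: "G False b u = F (turns False (b # u)) (turns False (b # u)) (length u)"
    "G True b u
      = F (Suc (turns True (b # u))) (turns True (b # u)) (length u) - x ^ Suc (turns False (b # u))"
    using Cons.IH[of b] Cons.prems by (auto simp: algebra_simps)
  have G: "G up a (b # u) = x ^ turns up (a # N # b # u)
      + x ^ (if up = (a < b) then 0 else 1) * G (a < b) b u" for up
    by (simp add: G_def sum.atMost_Suc_shift sum_distrib_left power_add del: sum.atMost_Suc)
  show ?case
    unfolding G using lt
    by (cases "a < b") (simp_all add: IH F_def algebra_simps del: sum.atMost_Suc)
qed

lemma sum_permutations_of_set_insert: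
  assumes "a \<notin> A"
  shows "sum f (permutations_of_set (insert a A)) =
    (\<Sum>v\<in>permutations_of_set A. \<Sum>i\<le>length v. f (take i v @ a # drop i v))"
proof -
  have "(\<Sum>v\<in>permutations_of_set A. \<Sum>i\<le>length v. f (take i v @ a # drop i v))
    = (\<Sum>(v, i)\<in>(SIGMA v:permutations_of_set A. {..length v}). f (take i v @ a # drop i v))"
    by (subst sum.Sigma) auto
  also have "\<dots> = sum f (permutations_of_set (insert a A))"
  proof (rule sum.reindex_bij_witness[where
        i = "\<lambda>w. (remove1 a w, length (takeWhile (\<lambda>b. b \<noteq> a) w))" and
        j = "\<lambda>(v, i). take i v @ a # drop i v"])
    fix p assume "p \<in> (SIGMA v:permutations_of_set A. {..length v})"
    then obtain v i where p: "p = (v, i)" "set v = A" "distinct v" "i \<le> length v"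
      by (auto simp: permutations_of_set_def)
    have un: "set (take i v) \<union> set (drop i v) = A" 
      using p(2) by (metis append_take_drop_id set_append)
    then have na: "a \<notin> set (take i v)" "a \<notin> set (drop i v)" using assms by auto
    then have "takeWhile (\<lambda>b. b \<noteq> a) (take i v) = take i v"
      by (auto simp: takeWhile_eq_all_conv)
    then show "(\<lambda>w. (remove1 a w, length (takeWhile (\<lambda>b. b \<noteq> a) w))) ((\<lambda>(v, i). take i v @ a # drop i v) p) = p"
      using na p by (auto simp: remove1_append takeWhile_append2 takeWhile_tail)
    show "(\<lambda>(v, i). take i v @ a # drop i v) p \<in> permutations_of_set (insert a A)"
      using na p un set_take_disj_set_drop_if_distinct[of v i i]
      by (auto simp: permutations_of_set_def)
    show "f ((\<lambda>(v, i). take i v @ a # drop i v) p) = (case p of (v, i) \<Rightarrow> f (take i v @ a # drop i v))"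
      using p by simp
  next
    fix w assume "w \<in> permutations_of_set (insert a A)"
    then have w: "set w = insert a A" "distinct w" by (auto simp: permutations_of_set_def)
    then obtain ys zs where yz: "w = ys @ a # zs" "a \<notin> set ys"
      by (metis insertI1 split_list_first)
    with w have "a \<notin> set zs" by auto
    moreover from yz have "takeWhile (\<lambda>b. b \<noteq> a) ys = ys"
      by (auto simp: takeWhile_eq_all_conv)
    ultimately show "(\<lambda>(v, i). take i v @ a # drop i v) (remove1 a w, length (takeWhile (\<lambda>b. b \<noteq> a) w)) = w"
      "(remove1 a w, length (takeWhile (\<lambda>b. b \<noteq> a) w)) \<in> (SIGMA v:permutations_of_set A. {..length v})"
      using yz w assms
      by (auto simp: remove1_append takeWhile_append2 takeWhile_tail permutations_of_set_def)
  qed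
  finally show ?thesis ..
qed

section \<open>Run polynomials as sums over words\<close>

lemma sum_permutes_perm_word:
  "(\<Sum>\<pi> | \<pi> permutes {1..n}. f (perm_word n \<pi>)) = sum f (permutations_of_set {1..n})"
proof -
  have inj: "inj_on (perm_word n) {\<pi>. \<pi> permutes {1..n}}"
  proof (rule inj_onI, rule ext)
    fix p q i assume *: "p \<in> {\<pi>. \<pi> permutes {1..n}}" "q \<in> {\<pi>. \<pi> permutes {1..n}}"
      and eq: "perm_word n p = perm_word n q"
    show "p i = q i"
    proof (cases "i \<in> {1..n}")
      case True
      then show ?thesis using eq by (auto simp: perm_word_def)
    next
      case False
      then show ?thesis using * by (simp add: permutes_not_in)
    qed
  qed
  have "perm_word n ` {\<pi>. \<pi> permutes {1..n}} = permutations_of_set {1..n}"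
  proof (rule card_subset_eq)
    have set: "set [1..<Suc n] = {1..n}" by auto
    show "perm_word n ` {\<pi>. \<pi> permutes {1..n}} \<subseteq> permutations_of_set {1..n}"
    proof safe
      fix p assume p: "p permutes {1..n}"
      show "perm_word n p \<in> permutations_of_set {1..n}"
        unfolding perm_word_def
        by (rule permutations_of_setI)
           (use p set in \<open>simp_all only: set_map distinct_map permutes_image permutes_inj_on distinct_upt simp_thms\<close>)
    qed
    show "card (perm_word n ` {\<pi>. \<pi> permutes {1..n}}) = card (permutations_of_set {1..n})"
      using card_image[OF inj] card_permutations[of "{1..n}" n] by simp
  qed simp
  then show ?thesis using sum.reindex[OF inj, of f] by simp
qed

text \<open>The letter \<open>0\<close> is followed by an ascent, so entering it downwards makes its position a
  turn.\<close>

lemma up_down_run_poly_eq: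
  "up_down_run_poly n = (\<Sum>v\<in>permutations_of_set {1..n}. [:0, 1:] ^ turns False (0 # v))"
proof -
  have "card (alternating_runs (0 # v)) = turns False (0 # v)"
    if "v \<in> permutations_of_set {1..n}" for v
  proof (cases v)
    case (Cons b u)
    have "0 \<notin> set v" "distinct v"
      using that by (auto simp: permutations_of_set_def)
    then have "distinct (0 # v)" "0 < b" using Cons by (auto intro: gr0I)
    then show ?thesis using card_alternating_runs[of "0 # v"] Cons by simp
  qed (use card_alternating_runs[of "[0::nat]"] in simp)
  then show ?thesis
    unfolding up_down_run_poly_def up_down_run_def monom_altdef
      sum_permutes_perm_word[where f = "\<lambda>v. smult 1 ([:0, 1:] ^ card (alternating_runs (0 # v)))"]
    by (intro sum.cong) auto
qed

lemma run_poly_eq: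
  "run_poly n = (\<Sum>v\<in>permutations_of_set {1..n}. [:0, 1:] ^ turns (\<not> v ! 0 < v ! 1) v)"
proof -
  have "card (alternating_runs v) = turns (\<not> v ! 0 < v ! 1) v"
    if "v \<in> permutations_of_set {1..n}" for v
    using that by (intro card_alternating_runs) (auto simp: permutations_of_set_def)
  then show ?thesis
    unfolding run_poly_def run_def monom_altdef
      sum_permutes_perm_word[where f = "\<lambda>v. smult 1 ([:0, 1:] ^ card (alternating_runs v))"]
    by (intro sum.cong) auto
qed

lemma pderiv_sum: "pderiv (sum f A) = (\<Sum>k\<in>A. pderiv (f k))"
  by (induction A rule: infinite_finite_induct) (simp_all add: pderiv_add)

text \<open>The summand \<open>k x^k\<close> that counts the gaps preserving the number of runs is \<open>x\<close> times the
  derivative of \<open>x^k\<close>.\<close>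

lemma up_down_run_poly_Suc:
  "up_down_run_poly (Suc n) =
     (of_nat n * [:0, 1:]\<^sup>2 + [:0, 1:]) * up_down_run_poly n
       + [:0, 1:] * [:1, 0, -1:] * pderiv (up_down_run_poly n)"
proof -
  let ?x = "[:0, 1:] :: int poly"
  let ?T = "\<lambda>v. turns False (0 # v)"
  have x2: "[:1, 0, -1:] = 1 - ?x\<^sup>2" by (simp add: power2_eq_square one_pCons)
  have dx: "?x * pderiv (?x ^ k) = of_nat k * ?x ^ k" for k
  proof (cases k)
    case (Suc i)
    have "pderiv ?x = 1" by (simp add: pderiv_pCons one_pCons)
    moreover have "smult (of_nat k) q = of_nat k * q" for q :: "int poly"
      by (simp add: of_nat_poly)
    ultimately show ?thesis
      unfolding Suc pderiv_power_Suc by (simp only: power_Suc mult_ac mult_1)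
  qed simp
  have ins: "(\<Sum>i\<le>length v. ?x ^ ?T (take i v @ Suc n # drop i v)) =
      (of_nat n * ?x\<^sup>2 + ?x) * ?x ^ ?T v + ?x * [:1, 0, -1:] * pderiv (?x ^ ?T v)"
    if "v \<in> permutations_of_set {1..n}" for v
  proof -
    have v: "length v = n" "\<forall>b\<in>set (0 # v). b < Suc n"
      using that length_finite_permutations_of_set[OF that] by (auto simp: permutations_of_set_def)
    have "?x * [:1, 0, -1:] * pderiv (?x ^ ?T v) = (1 - ?x\<^sup>2) * (of_nat (?T v) * ?x ^ ?T v)"
      unfolding x2 dx[symmetric] by (simp only: mult_ac)
    then show ?thesis
      using sum_turns_insert_max[OF v(2), of ?x, THEN conjunct1] v(1)
      by (simp only: algebra_simps power_add power2_eq_square power_Suc)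
  qed
  have "{1..Suc n} = insert (Suc n) {1..n}" by auto
  then show ?thesis
    unfolding up_down_run_poly_eq
    by (simp add: sum_permutations_of_set_insert ins pderiv_sum sum.distrib sum_distrib_left
        del: power_Suc)
qed

lemma up_down_run_poly_1: "up_down_run_poly (Suc 0) = [:0, 1:]"
proof -
  have "up_down_run_poly 0 = 1" by (simp add: up_down_run_poly_eq)
  then show ?thesis unfolding up_down_run_poly_Suc[of 0] by simp
qed

lemma run_poly_1: "run_poly (Suc 0) = 1"
  by (simp add: run_poly_eq)

lemma turns_map_antimono:
  assumes "\<And>a b. a \<in> set w \<Longrightarrow> b \<in> set w \<Longrightarrow> c a < c b \<longleftrightarrow> b < a" "distinct w"
  shows "turns (\<not> up) (map c w) = turns up w"
  using assms
proof (induction up w rule: turns.induct)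
  case (1 up a b w)
  then have "c a < c b \<longleftrightarrow> \<not> a < b" by auto
  moreover from 1 have "turns (\<not> a < b) (map c (b # w)) = turns (a < b) (b # w)"
    by auto
  ultimately show ?case by auto
qed auto

text \<open>A word and its complement have the same number of runs, and exactly one of them begins with a
  descent and gains a run from the prefixed \<open>0\<close>.\<close>

lemma run_poly_mult:
  assumes "n \<ge> 2"
  shows "[:1, 1:] * run_poly n = 2 * up_down_run_poly n"
proof -
  let ?x = "[:0, 1:] :: int poly" and ?P = "permutations_of_set {1..n}"
  let ?c = "\<lambda>k. n + 1 - k"
  let ?T = "\<lambda>v. turns False (0 # v)"
  have c: "inj_on ?c {1..n}" "?c ` {1..n} = {1..n}"
  proof -
    show "inj_on ?c {1..n}" by (auto simp: inj_on_def)
    show "?c ` {1..n} = {1..n}"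
    proof (rule endo_inj_surj)
      show "?c ` {1..n} \<subseteq> {1..n}" by auto
    qed (auto simp: inj_on_def)
  qed
  have "map ?c ` ?P = ?P"
    using permutations_of_set_image_inj[OF c(1)] unfolding c(2) by (rule sym)
  moreover have "inj_on (map ?c) ?P"
    by (rule inj_on_mapI, rule inj_on_subset[OF c(1)]) (auto simp: permutations_of_set_def)
  ultimately have compl: "(\<Sum>v\<in>?P. ?x ^ ?T (map ?c v)) = (\<Sum>v\<in>?P. ?x ^ ?T v)"
    using sum.reindex[of "map ?c" ?P "\<lambda>v. ?x ^ ?T v"] by simp
  have pair: "?x ^ ?T v + ?x ^ ?T (map ?c v) = [:1, 1:] * ?x ^ turns (\<not> v ! 0 < v ! 1) v"
    if "v \<in> ?P" for v
  proof -
    have v: "set v = {1..n}" "distinct v" "length v = n"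
      using that length_finite_permutations_of_set[OF that] by (auto simp: permutations_of_set_def)
    then obtain a b u where ab: "v = a # b # u"
      using assms by (cases v; cases "tl v") auto
    have "turns (\<not> False) (map ?c v) = turns False v"
      using v by (intro turns_map_antimono) auto
    moreover have "a \<in> {1..n}" unfolding v(1)[symmetric] ab by simp
    ultimately have "?T v = Suc (turns True v)" "?T (map ?c v) = Suc (turns False v)"
      using ab by simp_all
    moreover have "turns True v = (if a < b then 0 else 1) + turns (a < b) (b # u)"
      "turns False v = (if a < b then 1 else 0) + turns (a < b) (b # u)"
      "turns (\<not> v ! 0 < v ! 1) v = Suc (turns (a < b) (b # u))"
      using ab by simp_all
    moreover have "[:1, 1:] = 1 + ?x" by (simp add: one_pCons)
    ultimately show ?thesis
      by (cases "a < b") (simp_all only: if_True if_False add_0 plus_1_eq_Suc power_Suc algebra_simps mult_1)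
  qed
  have "2 * up_down_run_poly n = (\<Sum>v\<in>?P. ?x ^ ?T v) + (\<Sum>v\<in>?P. ?x ^ ?T (map ?c v))"
    unfolding compl up_down_run_poly_eq by simp
  also have "\<dots> = (\<Sum>v\<in>?P. ?x ^ ?T v + ?x ^ ?T (map ?c v))" by (simp only: sum.distrib)
  also have "\<dots> = [:1, 1:] * run_poly n"
    unfolding run_poly_eq sum_distrib_left by (rule sum.cong[OF refl pair])
  finally show ?thesis ..
qed

section \<open>Binomial convolution with the reciprocal generating function\<close>

text \<open>The coefficients of a product of two exponential generating functions.\<close>

definition binconv :: "(nat \<Rightarrow> 'r) \<Rightarrow> (nat \<Rightarrow> 'r) \<Rightarrow> nat \<Rightarrow> 'r::comm_ring_1" where
  "binconv f g n = (\<Sum>k\<le>n. of_nat (n choose k) * f k * g (n - k))"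

text \<open>The product rule for \<open>d/dz\<close> on exponential generating functions, on which \<open>d/dz\<close> acts as the
  shift of coefficients.\<close>

lemma binconv_Suc:
  "binconv f g (Suc n) = binconv (\<lambda>k. f (Suc k)) g n + binconv f (\<lambda>k. g (Suc k)) n"
proof -
  have "binconv f g (Suc n) = f 0 * g (Suc n) +
      (\<Sum>k\<le>n. of_nat (n choose k) * f (Suc k) * g (n - k)) +
      (\<Sum>k\<le>n. of_nat (n choose Suc k) * f (Suc k) * g (n - k))"
    unfolding binconv_def sum.atMost_Suc_shift
    by (simp add: algebra_simps sum.distrib)
  also have "f 0 * g (Suc n) + (\<Sum>k\<le>n. of_nat (n choose k) * f (Suc k) * g (n - k)) +
      (\<Sum>k\<le>n. of_nat (n choose Suc k) * f (Suc k) * g (n - k)) =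
      binconv (\<lambda>k. f (Suc k)) g n + (\<Sum>k\<le>Suc n. of_nat (n choose k) * f k * g (Suc n - k))"
    unfolding sum.atMost_Suc_shift by (simp add: binconv_def)
  also have "(\<Sum>k\<le>Suc n. of_nat (n choose k) * f k * g (Suc n - k)) = binconv f (\<lambda>k. g (Suc k)) n"
    by (simp add: binconv_def binomial_eq_0 Suc_diff_le)
  finally show ?thesis .
qed

text \<open>The product rule for \<open>z d/dz\<close>.\<close>

lemma binconv_of_nat:
  "of_nat n * binconv f g n = binconv (\<lambda>k. of_nat k * f k) g n + binconv f (\<lambda>k. of_nat k * g k) n"
  unfolding binconv_def sum_distrib_left sum.distrib[symmetric]
proof (rule sum.cong)
  fix k assume "k \<in> {..n}"
  then have "(of_nat n :: 'a) = of_nat k + of_nat (n - k)" by (simp flip: of_nat_add)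
  then show "of_nat n * (of_nat (n choose k) * f k * g (n - k)) =
      of_nat (n choose k) * (of_nat k * f k) * g (n - k) +
      of_nat (n choose k) * f k * (of_nat (n - k) * g (n - k))"
    by (simp add: algebra_simps)
qed simp

lemma pderiv_binconv:
  "pderiv (binconv f g n) = binconv (\<lambda>k. pderiv (f k)) g n + binconv f (\<lambda>k. pderiv (g k)) n"
  by (simp add: binconv_def pderiv_sum pderiv_mult sum.distrib algebra_simps pderiv_of_nat)

lemma binconv_add_left: "binconv (\<lambda>k. f k + g k) h n = binconv f h n + binconv g h n"
  and binconv_add_right: "binconv h (\<lambda>k. f k + g k) n = binconv h f n + binconv h g n"
  and binconv_mult_left: "binconv (\<lambda>k. c * f k) h n = c * binconv f h n"
  and binconv_mult_right: "binconv h (\<lambda>k. c * f k) n = c * binconv h f n"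
  by (simp_all add: binconv_def sum.distrib sum_distrib_left algebra_simps)

text \<open>With \<open>s\<^sup>2 = 1 - x\<^sup>2\<close>, these are the coefficients of
  \<open>1 - (1 + x) (sinh (s z) / s - (cosh (s z) - 1) / s\<^sup>2)\<close>, as an exponential generating function
  in \<open>z\<close>. Its reciprocal is that of the polynomials \<open>S\<^bsub>n+1\<^esub> / x\<close>.\<close>

definition denom_coeff :: "nat \<Rightarrow> int poly" where
  "denom_coeff k = (case k of 0 \<Rightarrow> 1
     | Suc j \<Rightarrow> - [:1, 1:] * (- 1) ^ j * [:1, 0, - 1:] ^ (j div 2))"

text \<open>This is the recurrence of \<open>S\<^bsub>k+1\<^esub>\<close> with the coefficient \<open>x\<^sup>2 + x\<close> of the term without \<open>k\<close> and
  derivative replaced by \<open>- (1 + x)\<close>. The proof computes directly, separating the parities of \<open>k\<close>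
  because of the rounded exponent.\<close>

lemma denom_coeff_Suc:
  "denom_coeff (Suc k) = of_nat k * [:0, 1:]\<^sup>2 * denom_coeff k
     - [:1, 1:] * denom_coeff k + [:0, 1:] * [:1, 0, - 1:] * pderiv (denom_coeff k)"
proof -
  let ?x = "[:0, 1:] :: int poly" and ?s = "[:1, 0, - 1:] :: int poly"
  have lin: "[:1, 1:] = 1 + ?x" and s: "?s = 1 - ?x * ?x"
    by (simp_all add: one_pCons)
  have ds: "?s * pderiv (?s ^ j) = - 2 * of_nat j * ?x * ?s ^ j" for j
  proof (cases j)
    case (Suc i)
    have "pderiv ?s = - 2 * ?x" by (simp add: pderiv_pCons numeral_poly)
    moreover have "smult (of_nat j) q = of_nat j * q" for q :: "int poly"
      by (simp add: of_nat_poly)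
    ultimately show ?thesis
      unfolding Suc pderiv_power_Suc by (simp only: power_Suc mult_ac)
  qed simp
  have d1: "pderiv (1 + ?x) = 1" by (simp add: pderiv_add pderiv_pCons one_pCons)
  consider "k = 0" | j where "k = Suc (2 * j)" | j where "k = Suc (Suc (2 * j))"
    by (metis even_Suc evenE oddE nat.exhaust Suc_eq_plus1)
  then show ?thesis
  proof cases
    case 1
    then show ?thesis by (simp add: denom_coeff_def)
  next
    case (2 j)
    have h: "denom_coeff k = - (1 + ?x) * ?s ^ j" "denom_coeff (Suc k) = (1 + ?x) * ?s ^ j"
      using 2 by (simp_all add: denom_coeff_def lin)
    have "?s * pderiv (denom_coeff k) = - ?s * ?s ^ j - (1 + ?x) * (?s * pderiv (?s ^ j))"
      unfolding h by (simp only: pderiv_mult pderiv_minus d1) algebra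
    then have D: "?x * ?s * pderiv (denom_coeff k)
        = ?x * (- ?s * ?s ^ j - (1 + ?x) * (- 2 * of_nat j * ?x * ?s ^ j))"
      unfolding ds by (simp only: mult.assoc)
    have k: "of_nat k = 1 + 2 * (of_nat j :: int poly)" using 2 by simp
    \<comment> \<open>Once \<open>1 - x\<^sup>2\<close> to the power \<open>j\<close> is replaced by an indeterminate \<open>t\<close>, the claim is a ring identity.\<close>
    have "(1 + x) * t = c * (x * x) * (- (1 + x) * t) - (1 + x) * (- (1 + x) * t)
        + x * (- r * t - (1 + x) * (- 2 * d * x * t))"
      if "c = 1 + 2 * d" "r = 1 - x * x" for x t c d r :: "int poly"
      unfolding that by (simp add: algebra_simps)
    from this[OF k s] show ?thesis
      unfolding D unfolding lin h power2_eq_square .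
  next
    case (3 j)
    have h: "denom_coeff k = (1 + ?x) * ?s ^ j" "denom_coeff (Suc k) = - (1 + ?x) * (?s * ?s ^ j)"
      using 3 by (simp_all add: denom_coeff_def lin)
    have "?s * pderiv (denom_coeff k) = ?s * ?s ^ j + (1 + ?x) * (?s * pderiv (?s ^ j))"
      unfolding h by (simp only: pderiv_mult d1) algebra
    then have D: "?x * ?s * pderiv (denom_coeff k)
        = ?x * (?s * ?s ^ j + (1 + ?x) * (- 2 * of_nat j * ?x * ?s ^ j))"
      unfolding ds by (simp only: mult.assoc)
    have k: "of_nat k = 2 + 2 * (of_nat j :: int poly)" using 3 by simp
    have "- (1 + x) * (r * t) = c * (x * x) * ((1 + x) * t) - (1 + x) * ((1 + x) * t)
        + x * (r * t + (1 + x) * (- 2 * d * x * t))"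
      if "c = 2 + 2 * d" "r = 1 - x * x" for x t c d r :: "int poly"
      unfolding that by (simp add: algebra_simps)
    from this[OF k s] show ?thesis
      unfolding D unfolding lin h power2_eq_square .
  qed
qed

text \<open>The recurrences of the two factors combine to
  \<open>E\<^bsub>n+1\<^esub> = n x\<^sup>2 E\<^sub>n - (1 - x\<^sup>2) E\<^sub>n + x (1 - x\<^sup>2) E\<^sub>n'\<close> for their convolution \<open>E\<close>. From
  \<open>E\<^sub>0 = x\<close> this gives \<open>E\<^sub>1 = 0\<close>, because \<open>x\<close> agrees with \<open>x\<close> times its derivative, and then
  all further terms are zero.\<close>

lemma binconv_denom_coeff:
  "binconv denom_coeff (\<lambda>k. up_down_run_poly (Suc k)) n = (if n = 0 then [:0, 1:] else 0)"
proof -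
  let ?x = "[:0, 1:] :: int poly" and ?s = "[:1, 0, - 1:] :: int poly"
  let ?F = "\<lambda>k. up_down_run_poly (Suc k)"
  let ?E = "binconv denom_coeff ?F"
  have F: "up_down_run_poly (Suc (Suc k)) = ?x\<^sup>2 * (of_nat k * ?F k)
      + ((?x\<^sup>2 + ?x) * ?F k + ?x * ?s * pderiv (?F k))" for k
    unfolding up_down_run_poly_Suc[of "Suc k"] of_nat_Suc by (simp only: algebra_simps)
  have H: "denom_coeff (Suc k) = ?x\<^sup>2 * (of_nat k * denom_coeff k)
      + ((- [:1, 1:]) * denom_coeff k + ?x * ?s * pderiv (denom_coeff k))" for k
    unfolding denom_coeff_Suc[of k] by (simp only: algebra_simps)
  have cancel: "(- [:1, 1:]) + (?x\<^sup>2 + ?x) = - ?s"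
    by (simp add: power2_eq_square)
  have E_Suc: "?E (Suc n) = ?x\<^sup>2 * of_nat n * ?E n - ?s * ?E n + ?x * ?s * pderiv (?E n)" for n
  proof -
    have "?E (Suc n) = ?x\<^sup>2 * (of_nat n * ?E n)
        + ((- [:1, 1:]) + (?x\<^sup>2 + ?x)) * ?E n + ?x * ?s * pderiv (?E n)"
      unfolding binconv_Suc H F binconv_of_nat pderiv_binconv binconv_add_left binconv_add_right
        binconv_mult_left binconv_mult_right by (simp only: algebra_simps)
    then show ?thesis unfolding cancel by (simp only: algebra_simps)
  qed
  have E0: "?E 0 = ?x"
    by (simp add: binconv_def denom_coeff_def up_down_run_poly_1)
  have E1: "?E (Suc 0) = 0"
    unfolding E_Suc[of 0] E0 by (simp add: pderiv_pCons)
  have "?E (Suc n) = 0" for n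
    by (induction n) (simp_all only: E1 E_Suc[of "Suc _"] mult_zero_right pderiv_0 diff_self add_0)
  then show ?thesis using E0 by (cases n) auto
qed

section \<open>The recurrences and divisibility\<close>

abbreviation rec_coeff :: "nat \<Rightarrow> nat \<Rightarrow> int poly" where
  "rec_coeff n r \<equiv> of_nat (n choose (r - 1)) * (- 1) ^ (n - r) * [:1, 0, - 1:] ^ ((n - r) div 2)"

lemma up_down_run_poly_rec:
  assumes "n \<ge> 1"
  shows "up_down_run_poly (n + 1) = [:1, 1:] * (\<Sum>r = 1..n. rec_coeff n r * up_down_run_poly r)"
proof -
  have "0 = binconv denom_coeff (\<lambda>k. up_down_run_poly (Suc k)) n"
    using assms by (simp add: binconv_denom_coeff)
  also have "\<dots> = up_down_run_poly (n + 1)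
      + (\<Sum>k=1..n. of_nat (n choose k) * denom_coeff k * up_down_run_poly (Suc (n - k)))"
    unfolding binconv_def atMost_atLeast0
    by (subst sum.atLeast_Suc_atMost) (simp_all add: denom_coeff_def)
  also have "(\<Sum>k=1..n. of_nat (n choose k) * denom_coeff k * up_down_run_poly (Suc (n - k))) =
      (\<Sum>r=1..n. - [:1, 1:] * (rec_coeff n r * up_down_run_poly r))"
  proof (rule sum.reindex_bij_witness[of _ "\<lambda>r. Suc n - r" "\<lambda>k. Suc n - k"])
    fix k assume k: "k \<in> {1..n}"
    then obtain j where j: "k = Suc j" "j < n" by (cases k) auto
    have "n choose (n - Suc j) = n choose Suc j"
      using j binomial_symmetric[of "Suc j" n] by simp
    with j have "rec_coeff n (Suc n - k) = of_nat (n choose k) * (- 1) ^ j * [:1, 0, - 1:] ^ (j div 2)"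
      by (simp add: Suc_diff_Suc)
    then show "- [:1, 1:] * (rec_coeff n (Suc n - k) * up_down_run_poly (Suc n - k)) =
        of_nat (n choose k) * denom_coeff k * up_down_run_poly (Suc (n - k))"
      using j by (simp only: denom_coeff_def nat.case Suc_diff_Suc diff_Suc_Suc) (simp only: mult_ac minus_mult_left minus_mult_right)
  qed auto
  also have "\<dots> = - ([:1, 1:] * (\<Sum>r = 1..n. rec_coeff n r * up_down_run_poly r))"
    by (simp only: sum_distrib_left mult_minus_left sum_negf)
  finally show ?thesis by (simp only: add_eq_0_iff2 eq_commute[of 0] minus_minus neg_eq_iff_add_eq_0)
qed

lemma run_poly_rec:
  assumes "n \<ge> 1"
  shows "run_poly (n + 1) =
    (- 1) ^ (n - 1) * [:- 1, 1:] * [:1, 0, - 1:] ^ ((n - 1) div 2)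
      + [:1, 1:] * (\<Sum>r = 1..n. rec_coeff n r * run_poly r)"
proof -
  have two: "2 * up_down_run_poly r
      = [:1, 1:] * run_poly r + (if r = 1 then [:- 1, 1:] else 0)" if "r \<ge> 1" for r
    using that run_poly_mult[of r]
    by (cases "r = 1") (simp_all add: up_down_run_poly_1 run_poly_1 numeral_poly)
  have "[:1, 1:] * run_poly (n + 1) = 2 * up_down_run_poly (n + 1)"
    using assms by (intro run_poly_mult) simp
  also have "\<dots> = [:1, 1:] * (\<Sum>r = 1..n. rec_coeff n r * (2 * up_down_run_poly r))"
    unfolding up_down_run_poly_rec[OF assms] sum_distrib_left by (simp only: mult_ac)
  also have "(\<Sum>r = 1..n. rec_coeff n r * (2 * up_down_run_poly r)) =
      (\<Sum>r = 1..n. [:1, 1:] * (rec_coeff n r * run_poly r)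
        + (if r = 1 then rec_coeff n 1 * [:- 1, 1:] else 0))"
  proof (intro sum.cong refl)
    fix r assume "r \<in> {1..n}"
    then have "rec_coeff n r * (2 * up_down_run_poly r)
        = rec_coeff n r * ([:1, 1:] * run_poly r + (if r = 1 then [:- 1, 1:] else 0))"
      using two[of r] by simp
    also have "\<dots> = [:1, 1:] * (rec_coeff n r * run_poly r)
        + (if r = 1 then rec_coeff n 1 * [:- 1, 1:] else 0)"
      by (simp only: distrib_left mult.left_commute[of "[:1, 1:]"] mult_zero_right if_distrib cong: if_cong) simp
    finally show "rec_coeff n r * (2 * up_down_run_poly r) = \<dots>" .
  qed
  also have "\<dots> = [:1, 1:] * (\<Sum>r = 1..n. rec_coeff n r * run_poly r) + rec_coeff n 1 * [:- 1, 1:]"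
    unfolding sum.distrib sum_distrib_left[symmetric] using assms by simp
  finally have "run_poly (n + 1)
      = [:1, 1:] * (\<Sum>r = 1..n. rec_coeff n r * run_poly r) + rec_coeff n 1 * [:- 1, 1:]"
    by (subst (asm) mult_cancel_left) (simp only: pCons_eq_0_iff one_neq_zero simp_thms)
  also have "rec_coeff n 1 * [:- 1, 1:]
      = (- 1) ^ (n - 1) * [:- 1, 1:] * [:1, 0, - 1:] ^ ((n - 1) div 2)"
    by (simp only: diff_self_eq_0 binomial_n_0 of_nat_1 mult_1 mult_ac)
  finally show ?thesis by (simp only: add.commute)
qed

text \<open>The \<open>r\<close>-th summand of the recurrence for \<open>S\<^bsub>m+1\<^esub>\<close> contains \<open>1 + x\<close> to the power
  \<open>\<lfloor>(m - r)/2\<rfloor>\<close> from \<open>1 - x\<^sup>2\<close> and \<open>\<lfloor>r/2\<rfloor>\<close> by induction. Rounding loses at most \<open>1\<close> in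
  total, and the factor \<open>1 + x\<close> in front of the sum makes up for it.\<close>

lemma dvd_up_down_run_poly: "n \<ge> 1 \<Longrightarrow> [:1, 1:] ^ (n div 2) dvd up_down_run_poly n"
proof (induction n rule: less_induct)
  case (less n)
  show ?case
  proof (cases "n = 1")
    case False
    then obtain m where m: "n = m + 1" "m \<ge> 1" using less.prems by (cases n) auto
    have s: "[:1, 1:] ^ k dvd ([:1, 0, - 1:] :: int poly) ^ k" for k
      by (rule dvd_power_same) (simp add: dvd_def, rule exI[of _ "[:1, -1:]"], simp)
    have "[:1, 1:] ^ ((m - 1) div 2) dvd rec_coeff m r * up_down_run_poly r" if "r \<in> {1..m}" for r
    proof -
      have "[:1, 1:] ^ ((m - r) div 2) * [:1, 1:] ^ (r div 2) dvd rec_coeff m r * up_down_run_poly r"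
        using that m less.IH[of r] s[of "(m - r) div 2"] by (intro mult_dvd_mono dvd_mult) auto
      moreover have "(a + b - 1) div 2 \<le> a div 2 + b div 2" for a b :: nat
        by presburger
      from this[of "m - r" r] have "(m - 1) div 2 \<le> (m - r) div 2 + r div 2"
        using that by simp
      then have "([:1, 1:] :: int poly) ^ ((m - 1) div 2) dvd [:1, 1:] ^ ((m - r) div 2) * [:1, 1:] ^ (r div 2)"
        unfolding power_add[symmetric] by (rule le_imp_power_dvd)
      ultimately show ?thesis using dvd_trans by blast
    qed
    then have "[:1, 1:] * [:1, 1:] ^ ((m - 1) div 2) dvd up_down_run_poly n"
      unfolding m(1) up_down_run_poly_rec[OF m(2)] by (intro mult_dvd_mono dvd_sum) auto
    moreover have "n div 2 = Suc ((m - 1) div 2)" using m by auto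
    ultimately show ?thesis by simp
  qed simp
qed

lemma dvd_run_poly:
  assumes "n \<ge> 2"
  shows "[:1, 1:] ^ (n div 2 - 1) dvd run_poly n"
proof -
  obtain k where k: "n div 2 = Suc k" using assms by (cases "n div 2") auto
  have "[:1, 1:] ^ (n div 2) dvd [:1, 1:] * run_poly n"
    unfolding run_poly_mult[OF assms] using assms by (intro dvd_mult dvd_up_down_run_poly) simp
  then have "[:1, 1:] * [:1, 1:] ^ k dvd [:1, 1:] * run_poly n"
    unfolding k power_Suc .
  then have "[:1, 1:] ^ k dvd run_poly n"
    by (subst (asm) dvd_mult_cancel_left) simp
  then show ?thesis unfolding k by simp
qed

theorem corollary12:
  shows
    "(\<forall>n\<ge>1. up_down_run_poly (n + 1) =
        [:1, 1:] * (\<Sum>r = 1..n.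
          of_nat (n choose (r - 1)) * (- 1) ^ (n - r) * [:1, 0, - 1:] ^ ((n - r) div 2) * up_down_run_poly r)) \<and>
     (\<forall>n\<ge>1. run_poly (n + 1) =
        (- 1) ^ (n - 1) * [:- 1, 1:] * [:1, 0, - 1:] ^ ((n - 1) div 2) +
        [:1, 1:] * (\<Sum>r = 2..n + 1.
          of_nat (n choose (r - 2)) * (- 1) ^ (n + 1 - r) * [:1, 0, - 1:] ^ ((n + 1 - r) div 2) * run_poly (r - 1))) \<and>
     (\<forall>n\<ge>1. [:1, 1:] ^ (n div 2) dvd up_down_run_poly n) \<and>
     (\<forall>n\<ge>2. [:1, 1:] ^ (n div 2 - 1) dvd run_poly n)"
proof (intro conjI allI impI)
  fix n :: nat assume n: "n \<ge> 1"
  have "(\<Sum>r = 2..n + 1. of_nat (n choose (r - 2)) * (- 1) ^ (n + 1 - r)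
        * [:1, 0, - 1:] ^ ((n + 1 - r) div 2) * run_poly (r - 1))
      = (\<Sum>r = 1..n. rec_coeff n r * run_poly r)"
    by (rule sum.reindex_bij_witness[of _ Suc "\<lambda>r. r - 1"]) (auto simp: numeral_2_eq_2)
  then show "run_poly (n + 1) =
        (- 1) ^ (n - 1) * [:- 1, 1:] * [:1, 0, - 1:] ^ ((n - 1) div 2) +
        [:1, 1:] * (\<Sum>r = 2..n + 1.
          of_nat (n choose (r - 2)) * (- 1) ^ (n + 1 - r) * [:1, 0, - 1:] ^ ((n + 1 - r) div 2) * run_poly (r - 1))"
    using run_poly_rec[OF n] by (simp only:)
qed (rule up_down_run_poly_rec dvd_up_down_run_poly dvd_run_poly, assumption)+

end
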